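(* Let $X\subset\mathbb R$ be a compact interval with non-empty interior, $N\ge2$ and $r\ge0$ integers, and let $\underline s=\{f_n\}_{n\in\mathbb N}$ be a Cauchy sequence in $\big(\mathcal{PC}^r_N(X),\operatorname{comp}^r\big)$. Then $\underline s$ is convergent in $\big(\mathcal{PC}^r_N(X),\operatorname{comp}^r\big)$ if and only if $\kappa(\underline s)=0$, where $\kappa(\underline s)$ is the collapse index of $\underline{s}$. In particular, any Cauchy sequence $\{f_n\}_{n\in\mathbb N}\subset\mathcal{PC}^r_N(X)$ such that $c_i^{f_n}=c_i^{f_{n+1}}$ for every $n\ge0$ and $i\in\{1,\dots,N-1\}$ is convergent.
   Context: Write $X=[c_0,c_N]$. A piecewise $\mathcal C^r$ map with $N$ continuity pieces is a map $f:X\to X$ together with a set $\Delta_f=\{c_1^f<\dots<c_{N-1}^f\}\subset \operatorname{int}(X)$ such that, with $X_1(f)=[c_0,c_1^f)$, $X_i(f)=(c_{i-1}^f,c_i^f)$ for $1<i<N$, $X_N(f)=(c_{N-1}^f,c_N]$ (the continuity pieces of $f$; $c_0^f:=c_0$, $c_N^f:=c_N$), $f$ is of class $\mathcal C^r$ on each $X_i(f)$ and, for every $0\le j\le r$, the derivative $f^{(j)}$ (with $f^{(0)}=f$) is uniformly continuous on each $X_i(f)$. (The points of $\Delta_f$ may be continuity points of $f$.) For $0\le j\le r$, $f_i^{(j)}:\overline{X_i(f)}\to\mathbb R$ denotes the unique continuous extension of $f^{(j)}|_{X_i(f)}$. Two such maps are identified when $\Delta_f=\Delta_g$ and $f=g$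 on $X\setminus\Delta_f$; $\mathcal{PC}^r_N(X)$ is the set of equivalence classes, and a class is denoted by any of its representatives. For $f,g\in\mathcal{PC}^r_N(X)$ let $\xi(f,g;\cdot):X\to X$ be the increasing piecewise linear homeomorphism $$\xi(f,g;x)=\frac{c_i^g-c_{i-1}^g}{c_i^f-c_{i-1}^f}(x-c_i^f)+c_i^g,\qquad x\in\overline{X_i(f)},\ 1\le i\le N.$$ The metric is $$\operatorname{comp}^r(f,g)=\sum_{i=1}^{N-1}|c_i^f-c_i^g|+\sum_{i=1}^N\sum_{j=0}^r\max_{x\in\overline{X_i(f)}}\big|f_i^{(j)}(x)-g_i^{(j)}(\xi(f,g;x))\big|.$$ The collapse index of a sequence $\underline s=\{f_n\}_{n\in\mathbb N}\subset\mathcal{PC}^r_N(X)$ is $$\kappa(\underline s)=\#\Big\{1\le i\le N:\ \lim_{n\to\infty}\big|c_{i-1}^{f_n}-c_i^{f_n}\big|=0\Big\}.$$ *)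

theory Defs
  imports "HOL-Analysis.Analysis"
begin

text \<open>Throughout, \<open>X = {a..b}\<close>. A representative of an element of \<open>PC\<^sup>r\<^sub>N(X)\<close> is a pair
  \<open>(f, D)\<close> with \<open>D = \<Delta>\<^sub>f\<close>; values of \<open>f\<close> outside \<open>X\<close> are irrelevant and are removed by the
  identification below.\<close>

type_synonym pcmap = "(real \<Rightarrow> real) \<times> real set"

text \<open>The points \<open>c\<^sub>0 < c\<^sub>1 < \<dots> < c\<^sub>N\<close>, where \<open>c\<^sub>0 = a\<close> and \<open>c\<^sub>N = b\<close>.\<close>

definition cpt :: "real \<Rightarrow> real \<Rightarrow> real set \<Rightarrow> nat \<Rightarrow> real" where
  "cpt a b D i = (a # sorted_list_of_set D @ [b]) ! i"

definition piece :: "nat \<Rightarrow> real \<Rightarrow> real \<Rightarrow> real set \<Rightarrow> nat \<Rightarrow> real set" where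
  "piece N a b D i =
    (if i = 1 then {cpt a b D 0..<cpt a b D 1}
     else if i = N then {cpt a b D (N - 1)<..cpt a b D N}
     else {cpt a b D (i - 1)<..<cpt a b D i})"

text \<open>Iterated derivative relative to \<open>S\<close>: one-sided at an endpoint of an interval that belongs
  to it, as is the case for \<open>a\<close> in the first piece and \<open>b\<close> in the last one.\<close>

primrec nderiv :: "nat \<Rightarrow> real set \<Rightarrow> (real \<Rightarrow> real) \<Rightarrow> real \<Rightarrow> real" where
  "nderiv 0 S f = f"
| "nderiv (Suc j) S f = (\<lambda>x. vector_derivative (nderiv j S f) (at x within S))"

definition class_C_on :: "nat \<Rightarrow> real set \<Rightarrow> (real \<Rightarrow> real) \<Rightarrow> bool" where
  "class_C_on r S f \<longleftrightarrow>
    (\<forall>j<r. nderiv j S f differentiable_on S) \<and> (\<forall>j\<le>r. continuous_on S (nderiv j S f))"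

definition pc_maps :: "nat \<Rightarrow> nat \<Rightarrow> real \<Rightarrow> real \<Rightarrow> pcmap set" where
  "pc_maps r N a b = {(f, D).
     f \<in> {a..b} \<rightarrow> {a..b} \<and>
     finite D \<and> card D = N - 1 \<and> D \<subseteq> interior {a..b} \<and>
     (\<forall>i\<in>{1..N}. class_C_on r (piece N a b D i) f \<and>
        (\<forall>j\<le>r. uniformly_continuous_on (piece N a b D i) (nderiv j (piece N a b D i) f)))}"

definition pc_rel :: "nat \<Rightarrow> nat \<Rightarrow> real \<Rightarrow> real \<Rightarrow> (pcmap \<times> pcmap) set" where
  "pc_rel r N a b = {((f, D), (g, E)).
     (f, D) \<in> pc_maps r N a b \<and> (g, E) \<in> pc_maps r N a b \<and>
     D = E \<and> (\<forall>x\<in>{a..b} - D. f x = g x)}"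

definition PC :: "nat \<Rightarrow> nat \<Rightarrow> real \<Rightarrow> real \<Rightarrow> pcmap set set" where
  "PC r N a b = pc_maps r N a b // pc_rel r N a b"

text \<open>Some representative of a class, used where the choice does not matter
  (see \<open>pc_break_class\<close> and \<open>pc_comp_class\<close>).\<close>

definition pc_rep :: "pcmap set \<Rightarrow> pcmap" where
  "pc_rep F = (SOME p. p \<in> F)"

definition pc_break :: "real \<Rightarrow> real \<Rightarrow> pcmap set \<Rightarrow> nat \<Rightarrow> real" where
  "pc_break a b F i = cpt a b (snd (pc_rep F)) i"

text \<open>The continuous extension of \<open>g\<close> from \<open>S\<close> to its closure; its values are determined
  on \<open>closure S\<close> only.\<close>

definition cont_ext :: "real set \<Rightarrow> (real \<Rightarrow> real) \<Rightarrow> real \<Rightarrow> real" where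
  "cont_ext S g = (SOME h. continuous_on (closure S) h \<and> (\<forall>x\<in>S. h x = g x))"

definition piece_ext :: "nat \<Rightarrow> real \<Rightarrow> real \<Rightarrow> pcmap \<Rightarrow> nat \<Rightarrow> nat \<Rightarrow> real \<Rightarrow> real" where
  "piece_ext N a b p i j =
     cont_ext (piece N a b (snd p) i) (nderiv j (piece N a b (snd p) i) (fst p))"

text \<open>At a common endpoint of two adjacent closed pieces both affine formulas give the same value
  (see \<open>pc_xi_eq\<close>), so selecting the least admissible index is no restriction.\<close>

definition pc_xi :: "real \<Rightarrow> real \<Rightarrow> real set \<Rightarrow> real set \<Rightarrow> real \<Rightarrow> real" where
  "pc_xi a b D E x =
    (let i = (LEAST i. 1 \<le> i \<and> x \<le> cpt a b D i) in
     (cpt a b E i - cpt a b E (i - 1)) / (cpt a b D i - cpt a b D (i - 1)) * (x - cpt a b D i)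
       + cpt a b E i)"

text \<open>The supremum is a maximum, of a continuous function on a compact interval.\<close>

definition pc_comp_rep :: "nat \<Rightarrow> nat \<Rightarrow> real \<Rightarrow> real \<Rightarrow> pcmap \<Rightarrow> pcmap \<Rightarrow> real" where
  "pc_comp_rep r N a b p q =
    (\<Sum>i=1..N - 1. \<bar>cpt a b (snd p) i - cpt a b (snd q) i\<bar>) +
    (\<Sum>i=1..N. \<Sum>j=0..r. SUP x\<in>closure (piece N a b (snd p) i).
       \<bar>piece_ext N a b p i j x - piece_ext N a b q i j (pc_xi a b (snd p) (snd q) x)\<bar>)"

text \<open>The value \<open>0\<close> off \<open>PC r N a b\<close> is a dummy: the library's metric spaces require a
  nonnegative and symmetric distance on the whole type.\<close>

definition pc_comp :: "nat \<Rightarrow> nat \<Rightarrow> real \<Rightarrow> real \<Rightarrow> pcmap set \<Rightarrow> pcmap set \<Rightarrow> real" where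
  "pc_comp r N a b F G =
    (if F \<in> PC r N a b \<and> G \<in> PC r N a b then pc_comp_rep r N a b (pc_rep F) (pc_rep G) else 0)"

definition collapse_index :: "nat \<Rightarrow> real \<Rightarrow> real \<Rightarrow> (nat \<Rightarrow> pcmap set) \<Rightarrow> nat" where
  "collapse_index N a b s =
    card {i\<in>{1..N}. (\<lambda>n. \<bar>pc_break a b (s n) (i - 1) - pc_break a b (s n) i\<bar>) \<longlonglongrightarrow> 0}"

abbreviation pc_Cauchy :: "nat \<Rightarrow> nat \<Rightarrow> real \<Rightarrow> real \<Rightarrow> (nat \<Rightarrow> pcmap set) \<Rightarrow> bool" where
  "pc_Cauchy r N a b s \<equiv> Metric_space.MCauchy (PC r N a b) (pc_comp r N a b) s"

abbreviation pc_convergent :: "nat \<Rightarrow> nat \<Rightarrow> real \<Rightarrow> real \<Rightarrow> (nat \<Rightarrow> pcmap set) \<Rightarrow> bool" where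
  "pc_convergent r N a b s \<equiv>
    \<exists>F. limitin (Metric_space.mtopology (PC r N a b) (pc_comp r N a b)) s F sequentially"


subsection \<open>The breakpoints and the pieces\<close>

lemma cpt_0 [simp]: "cpt a b D 0 = a"
  by (simp add: cpt_def)

lemma cpt_mem:
  assumes "finite D" "card D = N - 1" "1 \<le> i" "i < N"
  shows "cpt a b D i \<in> D"
proof -
  have l: "length (sorted_list_of_set D) = N - 1" using assms by simp
  have "cpt a b D i = sorted_list_of_set D ! (i - 1)"
    using assms l by (cases i) (auto simp: cpt_def nth_append)
  moreover have "sorted_list_of_set D ! (i - 1) \<in> set (sorted_list_of_set D)"
    using assms l by (intro nth_mem) auto
  ultimately show ?thesis using assms by simp
qed

lemma cpt_image:
  assumes "finite D" "card D = N - 1"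
  shows "D = cpt a b D ` {1..N - 1}"
proof
  show "cpt a b D ` {1..N - 1} \<subseteq> D"
    using cpt_mem[OF assms] by auto
  show "D \<subseteq> cpt a b D ` {1..N - 1}"
  proof
    fix x assume "x \<in> D"
    then have "x \<in> set (sorted_list_of_set D)" using assms by simp
    then obtain k where k: "k < N - 1" "x = sorted_list_of_set D ! k"
      using assms(2) by (metis in_set_conv_nth length_sorted_list_of_set)
    have "x = cpt a b D (Suc k)" using k assms by (simp add: cpt_def nth_append)
    then show "x \<in> cpt a b D ` {1..N - 1}" using k by auto
  qed
qed

lemma cpt_N:
  assumes "finite D" "card D = N - 1" "2 \<le> N"
  shows "cpt a b D N = b"
  using assms by (cases N) (auto simp: cpt_def nth_append)

lemma cpt_less:
  assumes "finite D" "card D = N - 1" "2 \<le> N" "D \<subseteq> {a<..<b}" "i < j" "j \<le> N"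
  shows "cpt a b D i < cpt a b D j"
proof -
  have "D \<noteq> {}" using assms by auto
  then have "a < b" using assms by fastforce
  then have "sorted_wrt (<) (a # sorted_list_of_set D @ [b])"
    using assms by (auto simp: sorted_wrt_append strict_sorted_list_of_set)
  then show ?thesis
    unfolding cpt_def using assms by (intro sorted_wrt_nth_less[of "(<)"]) simp_all
qed

lemma pc_mapsD:
  assumes "p \<in> pc_maps r N a b"
  shows "finite (snd p)" "card (snd p) = N - 1" "snd p \<subseteq> {a<..<b}"
    "\<And>i j. i \<in> {1..N} \<Longrightarrow> j \<le> r \<Longrightarrow>
      uniformly_continuous_on (piece N a b (snd p) i) (nderiv j (piece N a b (snd p) i) (fst p))"
  using assms by (auto simp: pc_maps_def)

lemma pc_maps_less:
  assumes "p \<in> pc_maps r N a b" "2 \<le> N" "i \<in> {1..N}"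
  shows "cpt a b (snd p) (i - 1) < cpt a b (snd p) i"
  using assms(3) by (intro cpt_less[OF pc_mapsD(1,2)[OF assms(1)] assms(2) pc_mapsD(3)[OF assms(1)]]) auto

lemma closure_piece:
  assumes "p \<in> pc_maps r N a b" "2 \<le> N" "i \<in> {1..N}"
  shows "closure (piece N a b (snd p) i) = {cpt a b (snd p) (i - 1)..cpt a b (snd p) i}"
  using pc_maps_less[OF assms] assms by (auto simp: piece_def)

lemma pieces_cover:
  assumes "p \<in> pc_maps r N a b" "2 \<le> N"
  shows "(\<Union>i\<in>{1..N}. piece N a b (snd p) i) = {a..b} - snd p"
proof -
  let ?D = "snd p"
  let ?c = "cpt a b ?D"
  note D = pc_mapsD(1-3)[OF assms(1)]
  note less = cpt_less[OF D(1,2) assms(2) D(3)]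
  have cN: "?c N = b" by (rule cpt_N[OF D(1,2) assms(2)])
  have le: "?c i \<le> ?c j" if "i \<le> j" "j \<le> N" for i j
    using less[of i j] that by (cases "i = j") auto
  show ?thesis
  proof
    show "(\<Union>i\<in>{1..N}. piece N a b ?D i) \<subseteq> {a..b} - ?D"
    proof (clarify)
      fix i x assume i: "i \<in> {1..N}" and x: "x \<in> piece N a b ?D i"
      have xb: "?c (i - 1) \<le> x" "x \<le> ?c i"
        using x by (auto simp: piece_def split: if_splits)
      have "x \<in> {a..b}"
        using xb le[of 0 "i - 1"] le[of i N] cN i by force
      moreover have "x \<notin> ?D"
      proof
        assume "x \<in> ?D"
        then obtain k where k: "k \<in> {1..N - 1}" "x = ?c k"
          using cpt_image[OF D(1,2)] by blast
        have "\<not> i \<le> k - 1"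
          using xb(2) k less[of i k] by force
        moreover have "\<not> k < i - 1"
          using xb(1) k less[of k "i - 1"] i by force
        ultimately have "k = i \<or> k = i - 1" using k by auto
        then show False
          using x k i pc_maps_less[OF assms i] assms(2) by (auto simp: piece_def split: if_splits)
      qed
      ultimately show "x \<in> {a..b} - ?D" by blast
    qed
    show "{a..b} - ?D \<subseteq> (\<Union>i\<in>{1..N}. piece N a b ?D i)"
    proof
      fix x assume x: "x \<in> {a..b} - ?D"
      have xn: "x \<noteq> ?c k" if "1 \<le> k" "k < N" for k
        using cpt_mem[OF D(1,2) that] x by auto
      define i where "i = (LEAST i. 1 \<le> i \<and> x \<le> ?c i)"
      have N: "1 \<le> N \<and> x \<le> ?c N" using x cN assms by simp
      have i: "1 \<le> i" "x \<le> ?c i" "i \<le> N"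
        using LeastI[of "\<lambda>i. 1 \<le> i \<and> x \<le> ?c i", OF N]
          Least_le[of "\<lambda>i. 1 \<le> i \<and> x \<le> ?c i", OF N] by (auto simp: i_def)
      have "?c (i - 1) < x" if "i \<noteq> 1"
        using not_less_Least[of "i - 1" "\<lambda>i. 1 \<le> i \<and> x \<le> ?c i"] i that by (auto simp: i_def)
      moreover have "x < ?c i" if "i \<noteq> N"
        using xn[of i] i that by auto
      ultimately have "x \<in> piece N a b ?D i"
        using i x assms(2) by (auto simp: piece_def)
      then show "x \<in> (\<Union>i\<in>{1..N}. piece N a b ?D i)" using i by auto
    qed
  qed
qed


subsection \<open>The reparametrisation\<close>

lemma pc_xi_eq:
  assumes "p \<in> pc_maps r N a b" "2 \<le> N" "i \<in> {1..N}"
    and "x \<in> closure (piece N a b (snd p) i)"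
  shows "pc_xi a b (snd p) E x =
    (cpt a b E i - cpt a b E (i - 1)) / (cpt a b (snd p) i - cpt a b (snd p) (i - 1))
      * (x - cpt a b (snd p) i) + cpt a b E i"
proof -
  let ?D = "snd p"
  let ?c = "cpt a b ?D"
  note D = pc_mapsD(1-3)[OF assms(1)]
  note less = cpt_less[OF D(1,2) assms(2) D(3)]
  have x: "?c (i - 1) \<le> x" "x \<le> ?c i"
    using assms closure_piece[OF assms(1-3)] by auto
  define k where "k = (LEAST i. 1 \<le> i \<and> x \<le> ?c i)"
  have P: "1 \<le> i \<and> x \<le> ?c i" using x assms by simp
  have k: "1 \<le> k" "x \<le> ?c k" "k \<le> i"
    using LeastI[of "\<lambda>i. 1 \<le> i \<and> x \<le> ?c i", OF P]
      Least_le[of "\<lambda>i. 1 \<le> i \<and> x \<le> ?c i", OF P] by (auto simp: k_def)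
  have xi: "pc_xi a b ?D E x =
      (cpt a b E k - cpt a b E (k - 1)) / (?c k - ?c (k - 1)) * (x - ?c k) + cpt a b E k"
    by (simp add: pc_xi_def k_def Let_def)
  show ?thesis
  proof (cases "k = i")
    case True
    then show ?thesis using xi by simp
  next
    case False
    have "\<not> k < i - 1" using less[of k "i - 1"] k x assms(3) by force
    then have ki: "k = i - 1" using k False by auto
    then have xe: "x = ?c (i - 1)" using k x by auto
    have "?c (i - 1) < ?c i" by (rule pc_maps_less[OF assms(1-3)])
    then show ?thesis using xi ki xe by (simp add: field_simps)
  qed
qed

lemma affine_interval:
  fixes u v u' v' x :: real
  assumes "u < v" "u' < v'" "x \<in> {u..v}"
  shows "(v' - u') / (v - u) * (x - v) + v' \<in> {u'..v'}"
proof -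
  have "(v' - u') / (v - u) * (v - x) \<ge> 0" using assms by simp
  moreover have "(v' - u') / (v - u) * (v - x) \<le> (v' - u') / (v - u) * (v - u)"
    using assms by (intro mult_left_mono) auto
  moreover have "(v' - u') / (v - u) * (v - u) = v' - u'" using assms by simp
  moreover have "(v' - u') / (v - u) * (x - v) = - ((v' - u') / (v - u) * (v - x))"
    by (metis minus_diff_eq mult_minus_right)
  ultimately show ?thesis by auto
qed

lemma pc_xi_mem:
  assumes "p \<in> pc_maps r N a b" "q \<in> pc_maps r N a b" "2 \<le> N" "i \<in> {1..N}"
    and "x \<in> closure (piece N a b (snd p) i)"
  shows "pc_xi a b (snd p) (snd q) x \<in> closure (piece N a b (snd q) i)"
  using affine_interval[OF pc_maps_less[OF assms(1,3,4)] pc_maps_less[OF assms(2,3,4)], of x]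
    assms(5) pc_xi_eq[OF assms(1,3,4,5)]
  by (simp add: closure_piece[OF assms(1,3,4)] closure_piece[OF assms(2,3,4)])

lemma pc_xi_comp:
  assumes "p \<in> pc_maps r N a b" "q \<in> pc_maps r N a b" "2 \<le> N" "i \<in> {1..N}"
    and "x \<in> closure (piece N a b (snd p) i)"
  shows "pc_xi a b (snd q) E (pc_xi a b (snd p) (snd q) x) = pc_xi a b (snd p) E x"
proof -
  have "pc_xi a b (snd q) E (pc_xi a b (snd p) (snd q) x) =
      (cpt a b E i - cpt a b E (i - 1)) / (cpt a b (snd q) i - cpt a b (snd q) (i - 1))
        * (pc_xi a b (snd p) (snd q) x - cpt a b (snd q) i) + cpt a b E i"
    by (rule pc_xi_eq[OF assms(2,3,4) pc_xi_mem[OF assms]])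
  then show ?thesis
    using pc_maps_less[OF assms(1,3,4)] pc_maps_less[OF assms(2,3,4)]
    unfolding pc_xi_eq[OF assms(1,3,4,5)] by simp
qed

lemma pc_xi_id:
  assumes "p \<in> pc_maps r N a b" "2 \<le> N" "i \<in> {1..N}"
    and "x \<in> closure (piece N a b (snd p) i)"
  shows "pc_xi a b (snd p) (snd p) x = x"
  using pc_maps_less[OF assms(1-3)] by (simp add: pc_xi_eq[OF assms])

lemma pc_xi_image:
  assumes "p \<in> pc_maps r N a b" "q \<in> pc_maps r N a b" "2 \<le> N" "i \<in> {1..N}"
  shows "pc_xi a b (snd p) (snd q) ` closure (piece N a b (snd p) i)
    = closure (piece N a b (snd q) i)"
proof
  show "pc_xi a b (snd p) (snd q) ` closure (piece N a b (snd p) i)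
      \<subseteq> closure (piece N a b (snd q) i)"
    using pc_xi_mem[OF assms] by blast
  show "closure (piece N a b (snd q) i)
      \<subseteq> pc_xi a b (snd p) (snd q) ` closure (piece N a b (snd p) i)"
  proof
    fix y assume y: "y \<in> closure (piece N a b (snd q) i)"
    have "y = pc_xi a b (snd p) (snd q) (pc_xi a b (snd q) (snd p) y)"
      using pc_xi_comp[OF assms(2,1,3,4) y] pc_xi_id[OF assms(2-4) y] by simp
    then show "y \<in> pc_xi a b (snd p) (snd q) ` closure (piece N a b (snd p) i)"
      using pc_xi_mem[OF assms(2,1,3,4) y] by blast
  qed
qed

lemma continuous_on_pc_xi:
  assumes "p \<in> pc_maps r N a b" "2 \<le> N" "i \<in> {1..N}"
  shows "continuous_on (closure (piece N a b (snd p) i)) (pc_xi a b (snd p) E)"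
  using pc_maps_less[OF assms]
  by (intro continuous_on_eq[OF _ pc_xi_eq[OF assms, symmetric]] continuous_intros) auto


subsection \<open>The continuous extensions\<close>

lemma cont_ext_works:
  assumes "uniformly_continuous_on S g"
  shows "continuous_on (closure S) (cont_ext S g)" "\<And>x. x \<in> S \<Longrightarrow> cont_ext S g x = g x"
proof -
  have "\<exists>h. continuous_on (closure S) h \<and> (\<forall>x\<in>S. h x = g x)"
    using uniformly_continuous_on_extension_on_closure[OF assms]
    by (metis uniformly_continuous_imp_continuous)
  then have "continuous_on (closure S) (cont_ext S g) \<and> (\<forall>x\<in>S. cont_ext S g x = g x)"
    unfolding cont_ext_def by (rule someI_ex)
  then show "continuous_on (closure S) (cont_ext S g)" "\<And>x. x \<in> S \<Longrightarrow> cont_ext S g x = g x"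
    by auto
qed

lemma cont_ext_unique:
  assumes "uniformly_continuous_on S g" "continuous_on (closure S) h"
    "\<And>x. x \<in> S \<Longrightarrow> h x = g x" "x \<in> closure S"
  shows "cont_ext S g x = h x"
proof -
  have "continuous_on (closure S) (\<lambda>x. cont_ext S g x - h x)"
    using cont_ext_works(1)[OF assms(1)] assms(2) by (rule continuous_on_diff)
  then have "cont_ext S g x - h x = 0"
    using continuous_constant_on_closure[of S "\<lambda>x. cont_ext S g x - h x" 0 x]
      cont_ext_works(2)[OF assms(1)] assms by auto
  then show ?thesis by simp
qed

lemma cont_ext_cong:
  assumes "\<And>x. x \<in> S \<Longrightarrow> f x = g x"
  shows "cont_ext S f = cont_ext S g"
  using assms by (simp add: cont_ext_def cong: conj_cong ball_cong)

lemma nderiv_cong: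
  assumes "\<And>x. x \<in> S \<Longrightarrow> f x = g x" "x \<in> S"
  shows "nderiv j S f x = nderiv j S g x"
  using assms(2)
proof (induction j arbitrary: x)
  case 0
  then show ?case using assms by simp
next
  case (Suc j)
  have "(nderiv j S f has_vector_derivative D) (at x within S) \<longleftrightarrow>
      (nderiv j S g has_vector_derivative D) (at x within S)" for D
    using Suc by (intro has_vector_derivative_cong_ev)
      (auto simp: eventually_at_filter)
  then show ?case by (simp add: vector_derivative_def)
qed

lemma piece_ext_cont:
  assumes "p \<in> pc_maps r N a b" "i \<in> {1..N}" "j \<le> r"
  shows "continuous_on (closure (piece N a b (snd p) i)) (piece_ext N a b p i j)"
  unfolding piece_ext_def by (rule cont_ext_works(1)[OF pc_mapsD(4)[OF assms]])

lemma piece_ext_class: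
  assumes "(p, q) \<in> pc_rel r N a b" "2 \<le> N" "i \<in> {1..N}"
  shows "piece_ext N a b p i j = piece_ext N a b q i j"
proof -
  have p: "p \<in> pc_maps r N a b" and s: "snd p = snd q"
    and e: "\<And>x. x \<in> {a..b} - snd p \<Longrightarrow> fst p x = fst q x"
    using assms(1) by (auto simp: pc_rel_def)
  have "fst p x = fst q x" if "x \<in> piece N a b (snd p) i" for x
    using e pieces_cover[OF p assms(2)] assms(3) that by blast
  then show ?thesis
    unfolding piece_ext_def s[symmetric] by (intro cont_ext_cong nderiv_cong)
qed


subsection \<open>Classes and their representatives\<close>

lemma equiv_pc_rel: "equiv (pc_maps r N a b) (pc_rel r N a b)"
  by (rule equivI) (auto simp: pc_rel_def refl_on_def sym_def trans_def)

lemma pc_rep_in: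
  assumes "F \<in> PC r N a b"
  shows "pc_rep F \<in> F" "pc_rep F \<in> pc_maps r N a b"
proof -
  have "F \<noteq> {}" using assms in_quotient_imp_non_empty[OF equiv_pc_rel] by (auto simp: PC_def)
  then show "pc_rep F \<in> F" unfolding pc_rep_def by (meson ex_in_conv someI_ex)
  then show "pc_rep F \<in> pc_maps r N a b"
    using in_quotient_imp_subset[OF equiv_pc_rel assms[unfolded PC_def]] by blast
qed

lemma pc_class_rel:
  assumes "F \<in> PC r N a b" "p \<in> F" "q \<in> F"
  shows "(p, q) \<in> pc_rel r N a b"
  using assms quotient_eq_iff[OF equiv_pc_rel, of F r N a b F p q] by (auto simp: PC_def)

lemma pc_break_class:
  assumes "F \<in> PC r N a b" "p \<in> F"
  shows "pc_break a b F i = cpt a b (snd p) i"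
  using pc_class_rel[OF assms(1) pc_rep_in(1)[OF assms(1)] assms(2)]
  by (auto simp: pc_break_def pc_rel_def)

lemma pc_comp_class:
  assumes "2 \<le> N" "F \<in> PC r N a b" "G \<in> PC r N a b" "p \<in> F" "q \<in> G"
  shows "pc_comp r N a b F G = pc_comp_rep r N a b p q"
proof -
  have P: "(pc_rep F, p) \<in> pc_rel r N a b" "(pc_rep G, q) \<in> pc_rel r N a b"
    using pc_class_rel pc_rep_in(1) assms by blast+
  then have s: "snd (pc_rep F) = snd p" "snd (pc_rep G) = snd q"
    by (auto simp: pc_rel_def)
  have "pc_comp_rep r N a b (pc_rep F) (pc_rep G) = pc_comp_rep r N a b p q"
    unfolding pc_comp_rep_def s
    by (intro arg_cong2[where f = "(+)"] refl sum.cong)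
       (simp add: piece_ext_class[OF P(1) assms(1)] piece_ext_class[OF P(2) assms(1)])
  then show ?thesis using assms by (simp add: pc_comp_def)
qed


subsection \<open>The metric\<close>

context
  fixes r N :: nat and a b :: real
  assumes N: "2 \<le> N"
begin

abbreviation (input) "gap p q i j x \<equiv>
  \<bar>piece_ext N a b p i j x - piece_ext N a b q i j (pc_xi a b (snd p) (snd q) x)\<bar>"

lemma gap_attains:
  assumes "p \<in> pc_maps r N a b" "q \<in> pc_maps r N a b" "i \<in> {1..N}" "j \<le> r"
  shows "\<exists>x\<in>closure (piece N a b (snd p) i). \<forall>y\<in>closure (piece N a b (snd p) i).
    gap p q i j y \<le> gap p q i j x"
proof (rule continuous_attains_sup)
  show "compact (closure (piece N a b (snd p) i))" "closure (piece N a b (snd p) i) \<noteq> {}"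
    using closure_piece[OF assms(1) N assms(3)] pc_maps_less[OF assms(1) N assms(3)] by auto
  have "continuous_on (closure (piece N a b (snd p) i))
      (\<lambda>x. piece_ext N a b q i j (pc_xi a b (snd p) (snd q) x))"
    using pc_xi_image[OF assms(1,2) N assms(3)]
    by (intro continuous_on_compose2[OF piece_ext_cont[OF assms(2-4)]]
        continuous_on_pc_xi[OF assms(1) N assms(3)]) auto
  then show "continuous_on (closure (piece N a b (snd p) i)) (gap p q i j)"
    by (intro continuous_intros piece_ext_cont[OF assms(1,3,4)])
qed

lemma gap_bdd:
  assumes "p \<in> pc_maps r N a b" "q \<in> pc_maps r N a b" "i \<in> {1..N}" "j \<le> r"
  shows "bdd_above (gap p q i j ` closure (piece N a b (snd p) i))"
  using gap_attains[OF assms] by (auto intro: bdd_aboveI2)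

lemma gap_le:
  assumes "p \<in> pc_maps r N a b" "q \<in> pc_maps r N a b" "i \<in> {1..N}" "j \<le> r"
    "x \<in> closure (piece N a b (snd p) i)"
  shows "gap p q i j x \<le> (SUP x\<in>closure (piece N a b (snd p) i). gap p q i j x)"
  using assms by (intro cSUP_upper gap_bdd) auto

lemma closure_piece_ne:
  assumes "p \<in> pc_maps r N a b" "i \<in> {1..N}"
  shows "closure (piece N a b (snd p) i) \<noteq> {}"
  using closure_piece[OF assms(1) N assms(2)] pc_maps_less[OF assms(1) N assms(2)] by auto

lemma sup_gap_nonneg:
  assumes "p \<in> pc_maps r N a b" "q \<in> pc_maps r N a b" "i \<in> {1..N}" "j \<le> r"
  shows "0 \<le> (SUP x\<in>closure (piece N a b (snd p) i). gap p q i j x)"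
proof -
  obtain x where "x \<in> closure (piece N a b (snd p) i)"
    using closure_piece_ne[OF assms(1,3)] by (meson ex_in_conv)
  from gap_le[OF assms this] show ?thesis by linarith
qed

lemma sup_gap_commute:
  assumes "p \<in> pc_maps r N a b" "q \<in> pc_maps r N a b" "i \<in> {1..N}"
  shows "(SUP x\<in>closure (piece N a b (snd p) i). gap p q i j x) =
    (SUP x\<in>closure (piece N a b (snd q) i). gap q p i j x)"
proof -
  have "(SUP x\<in>closure (piece N a b (snd q) i). gap q p i j x) =
      (SUP x\<in>closure (piece N a b (snd p) i). gap q p i j (pc_xi a b (snd p) (snd q) x))"
    unfolding pc_xi_image[OF assms(1,2) N assms(3), symmetric] by (simp add: image_image)
  also have "\<dots> = (SUP x\<in>closure (piece N a b (snd p) i). gap p q i j x)"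
    by (intro SUP_cong refl)
       (simp add: pc_xi_comp[OF assms(1,2) N assms(3)] pc_xi_id[OF assms(1) N assms(3)]
         abs_minus_commute)
  finally show ?thesis by simp
qed

lemma sup_gap_triangle:
  assumes "p \<in> pc_maps r N a b" "q \<in> pc_maps r N a b" "t \<in> pc_maps r N a b"
    "i \<in> {1..N}" "j \<le> r"
  shows "(SUP x\<in>closure (piece N a b (snd p) i). gap p t i j x) \<le>
    (SUP x\<in>closure (piece N a b (snd p) i). gap p q i j x) +
    (SUP x\<in>closure (piece N a b (snd q) i). gap q t i j x)"
proof (rule cSUP_least[OF closure_piece_ne[OF assms(1,4)]])
  fix x assume x: "x \<in> closure (piece N a b (snd p) i)"
  let ?y = "pc_xi a b (snd p) (snd q) x"
  have "gap p t i j x \<le> gap p q i j x + gap q t i j ?y"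
    using pc_xi_comp[OF assms(1,2) N assms(4) x, of "snd t"] by simp
  moreover have "gap p q i j x \<le> (SUP x\<in>closure (piece N a b (snd p) i). gap p q i j x)"
    by (rule gap_le[OF assms(1,2,4,5) x])
  moreover have "gap q t i j ?y \<le> (SUP x\<in>closure (piece N a b (snd q) i). gap q t i j x)"
    by (rule gap_le[OF assms(2,3,4,5) pc_xi_mem[OF assms(1,2) N assms(4) x]])
  ultimately show "gap p t i j x \<le>
      (SUP x\<in>closure (piece N a b (snd p) i). gap p q i j x) +
      (SUP x\<in>closure (piece N a b (snd q) i). gap q t i j x)"
    by linarith
qed

lemma pc_comp_rep_nonneg:
  assumes "p \<in> pc_maps r N a b" "q \<in> pc_maps r N a b"
  shows "0 \<le> pc_comp_rep r N a b p q"
  unfolding pc_comp_rep_def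
  by (intro add_nonneg_nonneg sum_nonneg sup_gap_nonneg[OF assms]) auto

lemma pc_comp_rep_commute:
  assumes "p \<in> pc_maps r N a b" "q \<in> pc_maps r N a b"
  shows "pc_comp_rep r N a b p q = pc_comp_rep r N a b q p"
  unfolding pc_comp_rep_def
  by (intro arg_cong2[where f = "(+)"] sum.cong refl abs_minus_commute sup_gap_commute[OF assms])

lemma pc_comp_rep_triangle:
  assumes "p \<in> pc_maps r N a b" "q \<in> pc_maps r N a b" "t \<in> pc_maps r N a b"
  shows "pc_comp_rep r N a b p t \<le> pc_comp_rep r N a b p q + pc_comp_rep r N a b q t"
proof -
  have "(\<Sum>i=1..N - 1. \<bar>cpt a b (snd p) i - cpt a b (snd t) i\<bar>) \<le>
      (\<Sum>i=1..N - 1. \<bar>cpt a b (snd p) i - cpt a b (snd q) i\<bar>) +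
      (\<Sum>i=1..N - 1. \<bar>cpt a b (snd q) i - cpt a b (snd t) i\<bar>)"
    unfolding sum.distrib[symmetric] by (rule sum_mono) linarith
  moreover have "(\<Sum>i=1..N. \<Sum>j=0..r. SUP x\<in>closure (piece N a b (snd p) i). gap p t i j x) \<le>
      (\<Sum>i=1..N. \<Sum>j=0..r. SUP x\<in>closure (piece N a b (snd p) i). gap p q i j x) +
      (\<Sum>i=1..N. \<Sum>j=0..r. SUP x\<in>closure (piece N a b (snd q) i). gap q t i j x)"
    unfolding sum.distrib[symmetric] by (intro sum_mono sup_gap_triangle[OF assms]) auto
  ultimately show ?thesis unfolding pc_comp_rep_def by linarith
qed

lemma pc_comp_rep_eq_0:
  assumes "p \<in> pc_maps r N a b" "q \<in> pc_maps r N a b"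
  shows "pc_comp_rep r N a b p q = 0 \<longleftrightarrow> (p, q) \<in> pc_rel r N a b"
proof
  assume "(p, q) \<in> pc_rel r N a b"
  then have s: "snd p = snd q"
    and e: "\<And>i j. i \<in> {1..N} \<Longrightarrow> piece_ext N a b p i j = piece_ext N a b q i j"
    using piece_ext_class[OF _ N] by (auto simp: pc_rel_def)
  have "(SUP x\<in>closure (piece N a b (snd p) i). gap p q i j x) = 0" if i: "i \<in> {1..N}" for i j
  proof -
    have "(SUP x\<in>closure (piece N a b (snd p) i). gap p q i j x) =
        (SUP x\<in>closure (piece N a b (snd p) i). 0)"
      using e[OF i] pc_xi_id[OF assms(1) N i] s by (intro SUP_cong) auto
    then show ?thesis using closure_piece_ne[OF assms(1) i] by simp
  qed
  then show "pc_comp_rep r N a b p q = 0" by (simp add: pc_comp_rep_def s)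
next
  assume z: "pc_comp_rep r N a b p q = 0"
  let ?A = "\<Sum>i=1..N - 1. \<bar>cpt a b (snd p) i - cpt a b (snd q) i\<bar>"
  let ?B = "\<Sum>i=1..N. \<Sum>j=0..r. SUP x\<in>closure (piece N a b (snd p) i). gap p q i j x"
  have "0 \<le> ?A" "0 \<le> ?B" "?A + ?B = 0"
    using z by (auto simp: pc_comp_rep_def intro!: sum_nonneg sup_gap_nonneg[OF assms])
  then have AB: "?A = 0" "?B = 0" by linarith+
  have ceq: "cpt a b (snd p) i = cpt a b (snd q) i" if "i \<in> {1..N - 1}" for i
    using AB(1) that by (subst (asm) sum_nonneg_eq_0_iff) auto
  have s: "snd p = snd q"
    using cpt_image[OF pc_mapsD(1,2)[OF assms(1)], of a b]
      cpt_image[OF pc_mapsD(1,2)[OF assms(2)], of a b] ceq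
    by (metis (no_types, lifting) image_cong)
  have s0: "(SUP x\<in>closure (piece N a b (snd p) i). gap p q i 0 x) = 0" if i: "i \<in> {1..N}" for i
  proof -
    have "(\<Sum>j=0..r. SUP x\<in>closure (piece N a b (snd p) i). gap p q i j x) = 0"
      using AB(2) i
      by (subst (asm) sum_nonneg_eq_0_iff) (auto intro!: sum_nonneg sup_gap_nonneg[OF assms])
    then show ?thesis
      using i by (subst (asm) sum_nonneg_eq_0_iff) (auto intro!: sup_gap_nonneg[OF assms])
  qed
  have "fst p x = fst q x" if xX: "x \<in> {a..b} - snd p" for x
  proof -
    obtain i where i: "i \<in> {1..N}" and x: "x \<in> piece N a b (snd p) i"
      using xX pieces_cover[OF assms(1) N] by (metis UN_E)
    have xc: "x \<in> closure (piece N a b (snd p) i)" using x closure_subset by (rule subsetD[rotated])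
    have "gap p q i 0 x \<le> 0"
      using gap_le[OF assms i _ xc, of 0] s0[OF i] by simp
    then have "piece_ext N a b p i 0 x = piece_ext N a b q i 0 x"
      using pc_xi_id[OF assms(1) N i xc] s by simp
    then show ?thesis
      using cont_ext_works(2)[OF pc_mapsD(4)[OF assms(1) i, of 0] x]
        cont_ext_works(2)[OF pc_mapsD(4)[OF assms(2) i, of 0], of x] x s
      by (simp add: piece_ext_def)
  qed
  then show "(p, q) \<in> pc_rel r N a b"
    using assms s by (cases p; cases q) (auto simp: pc_rel_def)
qed

end

theorem Metric_space_PC:
  assumes "2 \<le> N"
  shows "Metric_space (PC r N a b) (pc_comp r N a b)"
proof
  fix F G
  show "0 \<le> pc_comp r N a b F G"
    by (simp add: pc_comp_def pc_comp_rep_nonneg[OF assms] pc_rep_in(2))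
  show "pc_comp r N a b F G = pc_comp r N a b G F"
    using pc_comp_rep_commute[OF assms] pc_rep_in(2) by (auto simp: pc_comp_def)
next
  fix F G
  assume FG: "F \<in> PC r N a b" "G \<in> PC r N a b"
  have "F = G \<longleftrightarrow> (pc_rep F, pc_rep G) \<in> pc_rel r N a b"
    using quotient_eq_iff[OF equiv_pc_rel, of F r N a b G "pc_rep F" "pc_rep G"]
      FG pc_rep_in(1) by (auto simp: PC_def)
  then show "pc_comp r N a b F G = 0 \<longleftrightarrow> F = G"
    using pc_comp_rep_eq_0[OF assms] FG pc_rep_in(2) by (simp add: pc_comp_def)
next
  fix F G H
  assume "F \<in> PC r N a b" "G \<in> PC r N a b" "H \<in> PC r N a b"
  then show "pc_comp r N a b F H \<le> pc_comp r N a b F G + pc_comp r N a b G H"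
    using pc_comp_rep_triangle[OF assms] pc_rep_in(2) by (simp add: pc_comp_def)
qed

end

theory Submission
  imports Defs
begin

text \<open>A Cauchy sequence has convergent breakpoints, and the collapse index vanishes exactly when
  the limits are still distinct. In that case the limits bound the pieces of a candidate limit
  map; precomposing the extended derivatives with \<open>\<xi>\<close> moves them all to these fixed closed
  pieces, where they are uniformly Cauchy. The slopes of \<open>\<xi>\<close> tend to \<open>1\<close>, so the uniform limits
  are still successive derivatives of one another.\<close>

section \<open>Breakpoints, the metric and reparametrised pieces\<close>

text \<open>\<open>map c [1..<N]\<close> is strictly sorted, so it is the sorted list of its own
  set. This lets the limits of breakpoints serve as breakpoints with unchanged indices.\<close>

lemma cpt_strict_image:
  fixes c :: "nat \<Rightarrow> real"
  assumes "2 \<le> N" and c0: "c 0 = a" and cN: "c N = b" and less: "\<And>i. i < N \<Longrightarrow> c i < c (Suc i)"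
  shows "card (c ` {1..N - 1}) = N - 1" and "c ` {1..N - 1} \<subseteq> {a<..<b}"
    and "\<And>i. i \<le> N \<Longrightarrow> cpt a b (c ` {1..N - 1}) i = c i"
proof -
  have mono: "c i < c j" if "i < j" "j \<le> N" for i j
    using that
  proof (induction j)
    case (Suc j)
    then show ?case using less[of j] by (cases "i = j") auto
  qed simp
  have inj: "inj_on c {1..N - 1}"
    by (intro linorder_inj_onI) (use mono in force)+
  show card: "card (c ` {1..N - 1}) = N - 1"
    by (subst card_image[OF inj]) simp
  show "c ` {1..N - 1} \<subseteq> {a<..<b}"
    using mono[of 0] mono[of _ N] c0 cN by fastforce
  have "sorted_wrt (<) (map c [1..<N])"
    by (auto simp: sorted_wrt_iff_nth_less intro!: mono)
  moreover have "set (map c [1..<N]) = c ` {1..N - 1}"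
    using assms(1) by auto
  ultimately have "sorted_list_of_set (c ` {1..N - 1}) = map c [1..<N]"
    using card by (intro iffD1[OF sorted_list_of_set_unique]) auto
  then have "cpt a b (c ` {1..N - 1}) i = (a # map c [1..<N] @ [b]) ! i" for i
    by (simp add: cpt_def)
  then show "cpt a b (c ` {1..N - 1}) i = c i" if "i \<le> N" for i
    using that assms(1) c0 cN by (cases "i = N") (auto simp: nth_append nth_Cons')
qed

text \<open>The metric is a sum of nonnegative terms and hence dominates each of them; a supremum in
  turn dominates each value.\<close>

lemma pc_comp_rep_ge:
  assumes "2 \<le> N" "p \<in> pc_maps r N a b" "q \<in> pc_maps r N a b"
  shows "i \<le> N \<Longrightarrow> \<bar>cpt a b (snd p) i - cpt a b (snd q) i\<bar> \<le> pc_comp_rep r N a b p q"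
    and "i \<in> {1..N} \<Longrightarrow> j \<le> r \<Longrightarrow> x \<in> closure (piece N a b (snd p) i) \<Longrightarrow>
      \<bar>piece_ext N a b p i j x - piece_ext N a b q i j (pc_xi a b (snd p) (snd q) x)\<bar>
        \<le> pc_comp_rep r N a b p q"
proof -
  let ?S = "\<lambda>i j. SUP x\<in>closure (piece N a b (snd p) i).
    \<bar>piece_ext N a b p i j x - piece_ext N a b q i j (pc_xi a b (snd p) (snd q) x)\<bar>"
  let ?A = "\<Sum>i=1..N - 1. \<bar>cpt a b (snd p) i - cpt a b (snd q) i\<bar>"
  let ?B = "\<Sum>i=1..N. \<Sum>j=0..r. ?S i j"
  have comp: "pc_comp_rep r N a b p q = ?A + ?B" by (simp add: pc_comp_rep_def)
  have S: "0 \<le> ?S i j" if "i \<in> {1..N}" "j \<le> r" for i j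
    by (rule sup_gap_nonneg[OF assms that])
  have A: "0 \<le> ?A" by (simp add: sum_nonneg)
  have B: "0 \<le> ?B" by (intro sum_nonneg S) auto
  show "\<bar>cpt a b (snd p) i - cpt a b (snd q) i\<bar> \<le> pc_comp_rep r N a b p q" if "i \<le> N"
  proof (cases "i = 0 \<or> i = N")
    \<comment> \<open>The endpoints are common to all maps and do not enter the sum.\<close>
    case True
    then show ?thesis
      using cpt_N[OF pc_mapsD(1,2)[OF assms(2)] assms(1)]
        cpt_N[OF pc_mapsD(1,2)[OF assms(3)] assms(1)] A B comp by auto
  next
    case False
    then have "\<bar>cpt a b (snd p) i - cpt a b (snd q) i\<bar> \<le> ?A"
      using that by (intro member_le_sum) auto
    then show ?thesis using B comp by linarith
  qed
  show "\<bar>piece_ext N a b p i j x - piece_ext N a b q i j (pc_xi a b (snd p) (snd q) x)\<bar>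
        \<le> pc_comp_rep r N a b p q"
    if "i \<in> {1..N}" "j \<le> r" "x \<in> closure (piece N a b (snd p) i)"
  proof -
    note gap_le[OF assms that]
    also have "?S i j \<le> (\<Sum>j=0..r. ?S i j)"
      using that S by (intro member_le_sum) auto
    also have "\<dots> \<le> ?B"
      using that S by (intro member_le_sum[of i "{1..N}" "\<lambda>i. \<Sum>j=0..r. ?S i j"] sum_nonneg) auto
    finally show ?thesis using A comp by linarith
  qed
qed

text \<open>On each piece \<open>pc_xi\<close> is affine with positive slope, so strict inequalities
  survive. Derivatives live on the pieces themselves, hence this refinement of the statement for
  closures.\<close>

lemma piece_xi:
  assumes "p \<in> pc_maps r N a b" "q \<in> pc_maps r N a b" "2 \<le> N" "i \<in> {1..N}"
    and "x \<in> piece N a b (snd p) i"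
  shows "pc_xi a b (snd p) (snd q) x \<in> piece N a b (snd q) i"
proof -
  let ?c = "cpt a b (snd p)" and ?d = "cpt a b (snd q)"
  let ?k = "(?d i - ?d (i - 1)) / (?c i - ?c (i - 1))"
  note lt = pc_maps_less[OF assms(1,3,4)] pc_maps_less[OF assms(2,3,4)]
  have k: "?k > 0" using lt by simp
  have eq: "pc_xi a b (snd p) (snd q) x = ?k * (x - ?c i) + ?d i"
    using closure_subset assms(5) by (intro pc_xi_eq[OF assms(1,3,4)]) blast
  \<comment> \<open>The same affine map is anchored at the left endpoint, for the lower
    bounds.\<close>
  have "?k * (?c i - ?c (i - 1)) = ?d i - ?d (i - 1)" using lt by simp
  then have eq': "pc_xi a b (snd p) (snd q) x = ?k * (x - ?c (i - 1)) + ?d (i - 1)"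
    unfolding eq by (simp add: right_diff_distrib)
  have u: "pc_xi a b (snd p) (snd q) x < ?d i" if "x < ?c i"
    using mult_pos_neg[OF k, of "x - ?c i"] that eq by simp
  have l: "?d (i - 1) < pc_xi a b (snd p) (snd q) x" if "?c (i - 1) < x"
    using mult_pos_pos[OF k, of "x - ?c (i - 1)"] that eq' by simp
  have u': "pc_xi a b (snd p) (snd q) x \<le> ?d i" if "x \<le> ?c i"
    using mult_left_mono[of "x - ?c i" 0 ?k] that eq k by simp
  have l': "?d (i - 1) \<le> pc_xi a b (snd p) (snd q) x" if "?c (i - 1) \<le> x"
    using mult_left_mono[of 0 "x - ?c (i - 1)" ?k] that eq' k by simp
  consider "i = 1" | "i = N" "i \<noteq> 1" | "i \<noteq> 1" "i \<noteq> N" by blast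
  then show ?thesis
  proof cases
    case 1
    then show ?thesis using assms(5) u l' by (simp add: piece_def)
  next
    case 2
    then show ?thesis using assms(5) l u' by (simp add: piece_def)
  next
    case 3
    then show ?thesis
      using assms(5) u l by (simp add: piece_def)
  qed
qed

section \<open>Derivatives on the pieces and their uniform limits\<close>

text \<open>The facts on \<open>pc_xi\<close> ask for two maps of the same class; class
  \<open>0\<close> is the common ground with the constant placeholder map used below.\<close>

lemma pc_maps_0:
  assumes "p \<in> pc_maps r N a b"
  shows "p \<in> pc_maps 0 N a b"
proof -
  have "uniformly_continuous_on (piece N a b (snd p) i) (fst p)" if "i \<in> {1..N}" for i
    using pc_mapsD(4)[OF assms that, of 0] by simp
  then show ?thesis
    using assms by (auto simp: pc_maps_def class_C_on_def uniformly_continuous_imp_continuous)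
qed

lemma piece_convex: "convex (piece N a b D i)"
  by (simp add: piece_def)

text \<open>A nondegenerate interval has no isolated points. Hence derivatives within a piece are
  unique, also at an endpoint that belongs to it.\<close>

lemma piece_within_nontrivial:
  assumes "p \<in> pc_maps r N a b" "2 \<le> N" "i \<in> {1..N}" "x \<in> piece N a b (snd p) i"
  shows "at x within piece N a b (snd p) i \<noteq> bot"
proof -
  let ?c = "cpt a b (snd p)"
  have lt: "?c (i - 1) < ?c i" by (rule pc_maps_less[OF assms(1-3)])
  then have "infinite {?c (i - 1)<..<?c i}" by simp
  moreover have "{?c (i - 1)<..<?c i} \<subseteq> piece N a b (snd p) i"
    by (auto simp: piece_def)
  ultimately have "piece N a b (snd p) i \<noteq> {y}" for y
    using finite_subset[of _ "{y}"] by blast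
  then show ?thesis
    using connected_imp_perfect[OF convex_connected[OF piece_convex]] assms(4)
    by (simp add: trivial_limit_within)
qed

lemma pc_maps_nderiv:
  assumes "p \<in> pc_maps r N a b" "i \<in> {1..N}" "j < r" "x \<in> piece N a b (snd p) i"
  shows "(nderiv j (piece N a b (snd p) i) (fst p) has_real_derivative
    nderiv (Suc j) (piece N a b (snd p) i) (fst p) x) (at x within piece N a b (snd p) i)"
proof -
  have "nderiv j (piece N a b (snd p) i) (fst p) differentiable_on piece N a b (snd p) i"
    using assms(1-3) by (auto simp: pc_maps_def class_C_on_def)
  then show ?thesis
    using assms(4) by (simp add: differentiable_on_def vector_derivative_works
        has_real_derivative_iff_has_vector_derivative)
qed

text \<open>Serves to recognise a given chain of derivatives \<open>G\<close> as the iterated ones: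
  induction on \<open>j\<close>, with uniqueness of derivatives at non-isolated points.\<close>

lemma nderiv_eqI:
  assumes "\<And>x. x \<in> S \<Longrightarrow> at x within S \<noteq> bot"
    and "\<And>x. x \<in> S \<Longrightarrow> f x = G 0 x"
    and "\<And>j x. j < r \<Longrightarrow> x \<in> S \<Longrightarrow> (G j has_real_derivative G (Suc j) x) (at x within S)"
    and "j \<le> r" "x \<in> S"
  shows "nderiv j S f x = G j x"
  using assms(4,5)
proof (induction j arbitrary: x)
  case 0
  then show ?case using assms(2) by simp
next
  case (Suc j)
  have "(G j has_vector_derivative G (Suc j) x) (at x within S)"
    using assms(3)[of j x] Suc.prems by (simp add: has_real_derivative_iff_has_vector_derivative)
  then have "(nderiv j S f has_vector_derivative G (Suc j) x) (at x within S)"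
    by (rule has_vector_derivative_transform[rotated 2]) (use Suc.prems Suc.IH in \<open>simp_all add: Suc_leD\<close>)
  then show ?case
    using vector_derivative_within[OF assms(1)[OF Suc.prems(2)]] by simp
qed

text \<open>All conditions are transferred from \<open>G j\<close> to \<open>nderiv j S f\<close>,
  which agrees with it on \<open>S\<close>. The uniform limits constructed below will be such a
  chain.\<close>

lemma nderiv_class_C_onI:
  assumes "\<And>x. x \<in> S \<Longrightarrow> at x within S \<noteq> bot"
    and "\<And>x. x \<in> S \<Longrightarrow> f x = G 0 x"
    and "\<And>j x. j < r \<Longrightarrow> x \<in> S \<Longrightarrow> (G j has_real_derivative G (Suc j) x) (at x within S)"
    and "\<And>j. j \<le> r \<Longrightarrow> continuous_on S (G j)"
  shows "class_C_on r S f"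
proof -
  have eq: "nderiv j S f x = G j x" if "j \<le> r" "x \<in> S" for j x
    using nderiv_eqI[of S f G r] assms(1-3) that by blast
  have "continuous_on S (nderiv j S f)" if "j \<le> r" for j
    using continuous_on_cong[of S S "nderiv j S f" "G j"] assms(4)[OF that] eq[OF that] by blast
  moreover have "nderiv j S f differentiable_on S" if "j < r" for j
    unfolding differentiable_on_def
  proof
    fix x assume x: "x \<in> S"
    have "(nderiv j S f has_real_derivative G (Suc j) x) (at x within S)"
      using assms(3)[OF that x] x that
      by (subst has_field_derivative_cong_eventually[of _ "G j"])
        (auto simp: eventually_at_filter eq intro!: always_eventually)
    then show "nderiv j S f differentiable at x within S"
      by (auto simp: real_differentiable_def)
  qed
  ultimately show ?thesis by (simp add: class_C_on_def)
qed

text \<open>The derivatives are regarded as multiplication operators, whose distance in operator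
  norm is the distance of the factors; \<open>has_derivative_sequence\<close> then applies.\<close>

lemma uniform_limit_real_derivative:
  fixes f f' :: "nat \<Rightarrow> real \<Rightarrow> real"
  assumes "convex S"
    and "\<And>n x. x \<in> S \<Longrightarrow> (f n has_real_derivative f' n x) (at x within S)"
    and "uniform_limit S f' g' sequentially"
    and "\<And>x. x \<in> S \<Longrightarrow> (\<lambda>n. f n x) \<longlonglongrightarrow> g x"
    and "x \<in> S"
  shows "(g has_real_derivative g' x) (at x within S)"
proof -
  have "\<exists>k. \<forall>x\<in>S. (\<lambda>n. f n x) \<longlonglongrightarrow> k x \<and> (k has_derivative (*) (g' x)) (at x within S)"
  proof (rule has_derivative_sequence[OF assms(1), where f' = "\<lambda>n x. (*) (f' n x)"])
    show "\<And>n x. x \<in> S \<Longrightarrow> (f n has_derivative (*) (f' n x)) (at x within S)"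
      using assms(2) by (simp add: has_field_derivative_def)
    fix e :: real assume "e > 0"
    from uniform_limitD[OF assms(3) this]
    show "\<forall>\<^sub>F n in sequentially. \<forall>x\<in>S. \<forall>h. norm (f' n x * h - g' x * h) \<le> e * norm h"
    proof (rule eventually_mono, intro ballI allI)
      fix n x h assume "\<forall>x\<in>S. dist (f' n x) (g' x) < e" "x \<in> S"
      then have "\<bar>f' n x - g' x\<bar> * \<bar>h\<bar> \<le> e * \<bar>h\<bar>"
        by (intro mult_right_mono) (auto simp: dist_real_def less_imp_le)
      then show "norm (f' n x * h - g' x * h) \<le> e * norm h"
        by (simp add: abs_mult left_diff_distrib[symmetric])
    qed
  qed (use assms(4,5) in auto)
  then obtain k where k: "\<And>x. x \<in> S \<Longrightarrow> (\<lambda>n. f n x) \<longlonglongrightarrow> k x"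
    "\<And>x. x \<in> S \<Longrightarrow> (k has_real_derivative g' x) (at x within S)"
    by (auto simp: has_field_derivative_def)
  \<comment> \<open>\<open>has_derivative_sequence\<close> provides its own limit \<open>k\<close>;
    uniqueness of pointwise limits identifies it with \<open>g\<close> on \<open>S\<close>.\<close>
  have "g y = k y" if "y \<in> S" for y
    using LIMSEQ_unique[OF assms(4)[OF that] k(1)[OF that]] .
  then show ?thesis
    using k(2)[OF assms(5)] assms(5)
    by (subst has_field_derivative_cong_eventually[of _ k]) (auto simp: eventually_at_filter)
qed

text \<open>The chain rule for the affine \<open>pc_xi\<close>, whose slope becomes the factor. Of
  \<open>q\<close> only the breakpoints enter, so it is taken from class \<open>0\<close>; the
  placeholder map will be put in its place.\<close>

lemma pc_maps_affine_pullback_deriv: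
  assumes "p \<in> pc_maps r N a b" "q \<in> pc_maps 0 N a b" "2 \<le> N" "i \<in> {1..N}" "j < r"
    and x: "x \<in> piece N a b (snd q) i"
  shows "((\<lambda>x. piece_ext N a b p i j (pc_xi a b (snd q) (snd p) x)) has_real_derivative
      (cpt a b (snd p) i - cpt a b (snd p) (i - 1)) / (cpt a b (snd q) i - cpt a b (snd q) (i - 1))
        * piece_ext N a b p i (Suc j) (pc_xi a b (snd q) (snd p) x))
    (at x within piece N a b (snd q) i)"
proof -
  let ?S = "piece N a b (snd q) i" and ?T = "piece N a b (snd p) i"
  let ?xi = "pc_xi a b (snd q) (snd p)"
  let ?k = "(cpt a b (snd p) i - cpt a b (snd p) (i - 1)) /
    (cpt a b (snd q) i - cpt a b (snd q) (i - 1))"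
  have p0: "p \<in> pc_maps 0 N a b" by (rule pc_maps_0[OF assms(1)])
  have xi: "?xi y \<in> ?T" if "y \<in> ?S" for y by (rule piece_xi[OF assms(2) p0 assms(3,4) that])
  \<comment> \<open>On the piece itself the extensions are the derivatives, so the chain rule can be
    applied to \<open>nderiv\<close> and read back.\<close>
  have ext: "piece_ext N a b p i l y = nderiv l ?T (fst p) y" if "l \<le> r" "y \<in> ?T" for l y
    unfolding piece_ext_def by (rule cont_ext_works(2)[OF pc_mapsD(4)[OF assms(1,4) that(1)] that(2)])
  have "((\<lambda>y. k * (y - u) + v) has_real_derivative k) (at x within ?S)" for k u v
    by (auto intro!: derivative_eq_intros)
  from this[of ?k "cpt a b (snd q) i" "cpt a b (snd p) i"] have 1: "(?xi has_real_derivative ?k) (at x within ?S)"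
    using x closure_subset[of ?S]
    by (subst has_field_derivative_cong_eventually
        [of _ "\<lambda>y. ?k * (y - cpt a b (snd q) i) + cpt a b (snd p) i"])
      (auto simp: eventually_at_filter pc_xi_eq[OF assms(2-4)] subset_iff intro!: always_eventually)
  have "(nderiv j ?T (fst p) has_real_derivative nderiv (Suc j) ?T (fst p) (?xi x))
      (at (?xi x) within ?xi ` ?S)"
    by (rule has_field_derivative_subset[OF pc_maps_nderiv[OF assms(1,4,5) xi[OF x]]]) (use xi in blast)
  from DERIV_image_chain[OF this 1]
  have "(nderiv j ?T (fst p) \<circ> ?xi has_real_derivative
      ?k * piece_ext N a b p i (Suc j) (?xi x)) (at x within ?S)"
    using ext[of "Suc j" "?xi x"] assms(5) xi[OF x] by (simp add: mult.commute)
  then show ?thesis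
    using assms(5) x xi
    by (subst has_field_derivative_cong_eventually[of _ "nderiv j ?T (fst p) \<circ> ?xi"])
      (auto simp: eventually_at_filter ext intro!: always_eventually)
qed

text \<open>Ensures that a limit map defined through \<open>LEAST\<close> uses, on each piece, the
  function belonging to that piece.\<close>

lemma piece_index:
  assumes "p \<in> pc_maps r N a b" "2 \<le> N" "i \<in> {1..N}" "x \<in> piece N a b (snd p) i"
  shows "(LEAST i. 1 \<le> i \<and> x \<le> cpt a b (snd p) i) = i"
proof (rule Least_equality)
  show "1 \<le> i \<and> x \<le> cpt a b (snd p) i"
    using assms(3,4) by (auto simp: piece_def split: if_splits)
  fix k assume k: "1 \<le> k \<and> x \<le> cpt a b (snd p) k"
  show "i \<le> k"
  proof (rule ccontr)
    assume "\<not> i \<le> k"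
    then have "k = i - 1 \<or> k < i - 1" "i - 1 \<le> N" using assms(3) by auto
    then have "cpt a b (snd p) k \<le> cpt a b (snd p) (i - 1)"
      using cpt_less[OF pc_mapsD(1,2)[OF assms(1)] assms(2) pc_mapsD(3)[OF assms(1)], of k "i - 1"]
      by (auto simp: less_imp_le)
    \<comment> \<open>Since \<open>1 \<le> k\<close> and \<open>k < i\<close>, this is not the first
      piece, the only one containing its left endpoint.\<close>
    moreover have "cpt a b (snd p) (i - 1) < x"
      using assms(3,4) \<open>\<not> i \<le> k\<close> k by (auto simp: piece_def split: if_splits)
    ultimately show False using k by linarith
  qed
qed

lemma pc_maps_const:
  assumes "a < b" "finite D" "card D = N - 1" "D \<subseteq> {a<..<b}"
  shows "((\<lambda>_. a), D) \<in> pc_maps 0 N a b"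
  using assms by (auto simp: pc_maps_def class_C_on_def uniformly_continuous_on_const)

section \<open>Construction of the limit map\<close>

text \<open>Completeness when no piece collapses, stated for representatives so that functions and
  derivatives can be handled directly.\<close>

lemma pc_comp_rep_limit:
  fixes p :: "nat \<Rightarrow> pcmap"
  assumes N: "2 \<le> N" and "a < b"
    and p: "\<And>n. p n \<in> pc_maps r N a b"
    and Cauchy: "\<And>e. e > 0 \<Longrightarrow> \<exists>M. \<forall>m\<ge>M. \<forall>n\<ge>M. pc_comp_rep r N a b (p m) (p n) < e"
    and lim: "\<And>i. i \<le> N \<Longrightarrow> (\<lambda>n. cpt a b (snd (p n)) i) \<longlonglongrightarrow> c i"
    and less: "\<And>i. i < N \<Longrightarrow> c i < c (Suc i)"
  shows "\<exists>q\<in>pc_maps r N a b. (\<lambda>n. pc_comp_rep r N a b (p n) q) \<longlonglongrightarrow> 0"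
proof -
  have c0: "c 0 = a" using lim[of 0] by (simp add: LIMSEQ_const_iff)
  have "(\<lambda>n. b) \<longlonglongrightarrow> c N"
    using lim[of N] cpt_N[OF pc_mapsD(1,2)[OF p] N] by simp
  then have cN: "c N = b" by (simp add: LIMSEQ_const_iff)
  define D where "D = c ` {1..N - 1}"
  note D = cpt_strict_image[OF N c0 cN less, folded D_def]
  have finD: "finite D" by (simp add: D_def)
  \<comment> \<open>The constant map only serves to make the facts about \<^const>\<open>pc_xi\<close> available for the limit
    breakpoints before the limit map exists.\<close>
  define q0 :: pcmap where "q0 = ((\<lambda>_. a), D)"
  have q0: "q0 \<in> pc_maps 0 N a b"
    unfolding q0_def by (rule pc_maps_const[OF assms(2) finD D(1,2)])
  have snd_q0: "snd q0 = D" by (simp add: q0_def)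
  have p0: "p n \<in> pc_maps 0 N a b" for n by (rule pc_maps_0[OF p])
  define S where "S i = piece N a b D i" for i
  define K where "K i = closure (S i)" for i
  have SK: "S i \<subseteq> K i" for i by (simp add: K_def closure_subset)
  \<comment> \<open>\<open>xi n\<close> goes from the limit pieces to those of \<open>p n\<close>,
    so that for fixed \<open>i\<close> and \<open>j\<close> all \<open>h n i j\<close> share the
    domain \<open>K i\<close>.\<close>
  define xi where "xi n = pc_xi a b D (snd (p n))" for n
  define h where "h n i j = (\<lambda>x. piece_ext N a b (p n) i j (xi n x))" for n i j
  have xi_K: "xi n x \<in> closure (piece N a b (snd (p n)) i)" if "i \<in> {1..N}" "x \<in> K i" for n i x
    using pc_xi_mem[OF q0 p0 N that(1)] that(2) by (simp add: snd_q0 xi_def K_def S_def)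
  have xi_S: "xi n x \<in> piece N a b (snd (p n)) i" if "i \<in> {1..N}" "x \<in> S i" for n i x
    using piece_xi[OF q0 p0 N that(1)] that(2) by (simp add: snd_q0 xi_def S_def)
  have h_cont: "continuous_on (K i) (h n i j)" if "i \<in> {1..N}" "j \<le> r" for n i j
    unfolding h_def
  proof (rule continuous_on_compose2[OF piece_ext_cont[OF p that]])
    show "continuous_on (K i) (xi n)"
      using continuous_on_pc_xi[OF q0 N that(1)] by (simp add: snd_q0 xi_def K_def S_def)
  qed (use xi_K that in auto)
  have h_dist: "\<bar>h m i j x - h n i j x\<bar> \<le> pc_comp_rep r N a b (p m) (p n)"
    if "i \<in> {1..N}" "j \<le> r" "x \<in> K i" for m n i j x
  proof -
    \<comment> \<open>Reparametrisations compose, so the difference is the one measured by the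
      metric at the point \<open>xi m x\<close>.\<close>
    have "pc_xi a b (snd (p m)) (snd (p n)) (xi m x) = xi n x"
      using pc_xi_comp[OF q0 p0 N that(1)] that(3) by (simp add: snd_q0 xi_def K_def S_def)
    then show ?thesis
      using pc_comp_rep_ge(2)[OF N p p that(1,2) xi_K[OF that(1,3)], of m n] by (simp add: h_def)
  qed
  have "\<exists>l. uniform_limit (K i) (\<lambda>n. h n i j) l sequentially" if "i \<in> {1..N}" "j \<le> r" for i j
  proof -
    have "uniformly_Cauchy_on (K i) (\<lambda>n. h n i j)"
    proof (rule uniformly_Cauchy_onI)
      fix e :: real assume "e > 0"
      then obtain M where "\<forall>m\<ge>M. \<forall>n\<ge>M. pc_comp_rep r N a b (p m) (p n) < e"
        using Cauchy by blast
      then show "\<exists>M. \<forall>x\<in>K i. \<forall>m\<ge>M. \<forall>n\<ge>M. dist (h m i j x) (h n i j x) < e"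
        using h_dist[OF that] by (metis dist_real_def le_less_trans)
    qed
    then show ?thesis
      by (simp add: uniformly_convergent_eq_Cauchy[symmetric] uniformly_convergent_on_def)
  qed
  \<comment> \<open>Guarding inside the existential lets choice give one family
    \<open>H\<close>.\<close>
  then have "\<forall>i j. \<exists>l. i \<in> {1..N} \<and> j \<le> r \<longrightarrow> uniform_limit (K i) (\<lambda>n. h n i j) l sequentially"
    by blast
  then obtain H where H: "\<And>i j. i \<in> {1..N} \<Longrightarrow> j \<le> r \<Longrightarrow>
      uniform_limit (K i) (\<lambda>n. h n i j) (H i j) sequentially"
    by metis
  have H_cont: "continuous_on (K i) (H i j)" if "i \<in> {1..N}" "j \<le> r" for i j
    by (rule uniform_limit_theorem[OF _ H[OF that]]) (use h_cont[OF that] in auto)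
  have K_compact: "compact (K i)" if "i \<in> {1..N}" for i
    using closure_piece[OF q0 N that] by (simp add: K_def S_def snd_q0)
  have H_deriv: "(H i j has_real_derivative H i (Suc j) x) (at x within S i)"
    if i: "i \<in> {1..N}" and j: "j < r" and x: "x \<in> S i" for i j x
  proof -
    \<comment> \<open>\<open>k n\<close> is the slope of \<open>xi n\<close> on \<open>K i\<close>.
      The breakpoints of \<open>D\<close> are the values of \<open>c\<close>, so the numerator tends
      to the denominator, which is positive; hence the limit \<open>1\<close>.\<close>
    define k where "k n = (cpt a b (snd (p n)) i - cpt a b (snd (p n)) (i - 1)) /
      (cpt a b D i - cpt a b D (i - 1))" for n
    have "c (i - 1) < c i" using less[of "i - 1"] i by (cases i) auto
    then have "k \<longlonglongrightarrow> (c i - c (i - 1)) / (c i - c (i - 1))"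
      unfolding k_def using i D(3) by (intro tendsto_intros tendsto_eq_intros lim) auto
    then have "k \<longlonglongrightarrow> 1" using \<open>c (i - 1) < c i\<close> by simp
    then have k: "uniform_limit (K i) (\<lambda>n x. k n) (\<lambda>x. 1) sequentially"
      by (auto simp: uniform_limit_iff tendsto_iff elim: eventually_mono)
    \<comment> \<open>Uniform limits multiply when both limit functions are bounded.\<close>
    have "bounded (H i (Suc j) ` K i)"
      using K_compact[OF i] H_cont[OF i, of "Suc j"] j
      by (intro compact_imp_bounded compact_continuous_image) auto
    from uniform_lim_mult[OF k H[OF i, of "Suc j"] _ this]
    have "uniform_limit (K i) (\<lambda>n x. k n * h n i (Suc j) x) (H i (Suc j)) sequentially"
      using j by (simp add: image_constant_conv)
    then have "uniform_limit (S i) (\<lambda>n x. k n * h n i (Suc j) x) (H i (Suc j)) sequentially"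
      using SK uniform_limit_on_subset by blast
    moreover have "(h n i j has_real_derivative k n * h n i (Suc j) y) (at y within S i)"
      if "y \<in> S i" for n y
      using pc_maps_affine_pullback_deriv[OF p q0 N i j, of y n] that
      by (simp add: h_def k_def xi_def S_def snd_q0)
    moreover have "(\<lambda>n. h n i j y) \<longlonglongrightarrow> H i j y" if "y \<in> S i" for y
      using tendsto_uniform_limitI[OF H[OF i]] SK j that by (meson less_imp_le subsetD)
    ultimately show ?thesis
      using x by (intro uniform_limit_real_derivative[where f = "\<lambda>n. h n i j"])
        (auto simp: S_def piece_convex)
  qed
  \<comment> \<open>On \<open>D\<close> the value \<open>a\<close> is a filler: the identification
    forgets it, but it has to lie in \<open>{a..b}\<close>.\<close>
  define F where "F x = (if x \<in> {a..b} - D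
    then H (LEAST i. 1 \<le> i \<and> x \<le> cpt a b D i) 0 x else a)" for x
  have cover: "(\<Union>i\<in>{1..N}. S i) = {a..b} - D"
    using pieces_cover[OF q0 N] by (simp add: S_def snd_q0)
  have F_eq: "F x = H i 0 x" if "i \<in> {1..N}" "x \<in> S i" for i x
    using piece_index[OF q0 N that(1), of x] that cover by (auto simp: F_def S_def snd_q0)
  have F_mem: "F x \<in> {a..b}" if x: "x \<in> {a..b}" for x
  proof (cases "x \<in> D")
    case True
    then show ?thesis using assms(2) by (simp add: F_def)
  next
    case False
    then obtain i where i: "i \<in> {1..N}" "x \<in> S i" using cover x by blast
    \<comment> \<open>At a point of \<open>S i\<close> the pullback is a genuine value of
      \<open>p n\<close>, and a closed interval keeps limits.\<close>
    have "h n i 0 x \<in> {a..b}" for n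
    proof -
      have "xi n x \<in> {a..b}" using pieces_cover[OF p N, of n] xi_S[OF i, of n] i(1) by blast
      moreover have "h n i 0 x = fst (p n) (xi n x)"
        using cont_ext_works(2)[OF pc_mapsD(4)[OF p i(1)] xi_S[OF i], of 0]
        by (simp add: h_def piece_ext_def)
      ultimately show ?thesis using p[of n] by (auto simp: pc_maps_def)
    qed
    moreover have "(\<lambda>n. h n i 0 x) \<longlonglongrightarrow> H i 0 x"
      using tendsto_uniform_limitI[OF H[OF i(1)]] SK i(2) by blast
    ultimately have "H i 0 x \<in> {a..b}"
      by (meson closed_atLeastAtMost closed_sequentially)
    then show ?thesis using F_eq[OF i] by simp
  qed
  have nontriv: "at x within S i \<noteq> bot" if "i \<in> {1..N}" "x \<in> S i" for i x
    using piece_within_nontrivial[OF q0 N that(1)] that(2) by (simp add: S_def snd_q0)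
  have nd: "nderiv j (S i) F x = H i j x" if "i \<in> {1..N}" "j \<le> r" "x \<in> S i" for i j x
    by (rule nderiv_eqI[OF nontriv F_eq H_deriv that(2,3)]) (use that(1) in auto)
  have uc: "uniformly_continuous_on (S i) (nderiv j (S i) F)" if "i \<in> {1..N}" "j \<le> r" for i j
  proof -
    have "uniformly_continuous_on (S i) (H i j)"
      using compact_uniformly_continuous[OF H_cont[OF that] K_compact[OF that(1)]] SK[of i]
      unfolding uniformly_continuous_on_def by (meson subsetD)
    then show ?thesis using nd[OF that] by (simp add: uniformly_continuous_on_def)
  qed
  have CC: "class_C_on r (S i) F" if "i \<in> {1..N}" for i
  proof (rule nderiv_class_C_onI[where G = "H i", OF nontriv F_eq H_deriv])
    show "continuous_on (S i) (H i j)" if "j \<le> r" for j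
      using H_cont[OF \<open>i \<in> {1..N}\<close> that] SK by (rule continuous_on_subset)
  qed (use that in auto)
  define q where "q = (F, D)"
  have snd_q: "snd q = D" by (simp add: q_def)
  have q: "q \<in> pc_maps r N a b"
    using F_mem finD D(1,2) CC uc by (auto simp: pc_maps_def q_def S_def)
  \<comment> \<open>\<open>H i j\<close> is continuous on the closure, so it is the unique
    extension, and the metric can be computed from \<open>H\<close>.\<close>
  have ext: "piece_ext N a b q i j x = H i j x" if "i \<in> {1..N}" "j \<le> r" "x \<in> K i" for i j x
    unfolding piece_ext_def
    using cont_ext_unique[OF uc[OF that(1,2)] H_cont[OF that(1,2), unfolded K_def], of x] that nd
    by (simp add: q_def S_def K_def)
  have breaks: "(\<lambda>n. \<bar>cpt a b D i - cpt a b (snd (p n)) i\<bar>) \<longlonglongrightarrow> 0" if "i \<in> {1..N - 1}" for i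
  proof -
    have "(\<lambda>n. \<bar>c i - cpt a b (snd (p n)) i\<bar>) \<longlonglongrightarrow> \<bar>c i - c i\<bar>"
      using that by (intro tendsto_intros lim) auto
    moreover have "cpt a b D i = c i" using that by (intro D(3)) auto
    ultimately show ?thesis by simp
  qed
  have sups: "(\<lambda>n. SUP x\<in>K i. \<bar>H i j x - h n i j x\<bar>) \<longlonglongrightarrow> 0"
    if ij: "i \<in> {1..N}" "j \<le> r" for i j
  proof (rule LIMSEQ_I)
    fix e :: real assume "0 < e"
    \<comment> \<open>Suprema preserve only weak bounds; with half of \<open>e\<close> the final
      bound is strict.\<close>
    then have "0 < e / 2" by simp
    obtain y where y: "y \<in> K i"
      using closure_piece_ne[OF N q0 ij(1)] unfolding K_def S_def snd_q0 by (meson ex_in_conv)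
    from uniform_limitD[OF H[OF ij] \<open>0 < e / 2\<close>] obtain M where
      M: "\<And>n x. n \<ge> M \<Longrightarrow> x \<in> K i \<Longrightarrow> \<bar>H i j x - h n i j x\<bar> \<le> e / 2"
      by (fastforce simp: eventually_sequentially dist_real_def abs_minus_commute)
    have "norm ((SUP x\<in>K i. \<bar>H i j x - h n i j x\<bar>) - 0) < e" if "n \<ge> M" for n
    proof -
      have "(SUP x\<in>K i. \<bar>H i j x - h n i j x\<bar>) \<le> e / 2"
        using y by (intro cSUP_least M that) auto
      \<comment> \<open>A single point \<open>y\<close> shows that the supremum is
        nonnegative.\<close>
      moreover have "\<bar>H i j y - h n i j y\<bar> \<le> (SUP x\<in>K i. \<bar>H i j x - h n i j x\<bar>)"
        using y M[OF that] by (intro cSUP_upper bdd_aboveI2[where M = "e / 2"]) auto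
      ultimately show ?thesis using \<open>0 < e\<close> by auto
    qed
    then show "\<exists>M. \<forall>n\<ge>M. norm ((SUP x\<in>K i. \<bar>H i j x - h n i j x\<bar>) - 0) < e" by blast
  qed
  \<comment> \<open>The distance is expanded with \<open>q\<close> first, since then the suprema
    range over the fixed sets \<open>K i\<close>; symmetry turns it round afterwards.\<close>
  have "pc_comp_rep r N a b q (p n) =
      (\<Sum>i=1..N - 1. \<bar>cpt a b D i - cpt a b (snd (p n)) i\<bar>) +
      (\<Sum>i=1..N. \<Sum>j=0..r. SUP x\<in>K i. \<bar>H i j x - h n i j x\<bar>)" for n
    unfolding pc_comp_rep_def snd_q
    by (intro arg_cong2[where f = "(+)"] refl sum.cong SUP_cong)
      (auto simp: ext h_def xi_def K_def S_def)
  moreover have "(\<lambda>n. (\<Sum>i=1..N - 1. \<bar>cpt a b D i - cpt a b (snd (p n)) i\<bar>) +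
      (\<Sum>i=1..N. \<Sum>j=0..r. SUP x\<in>K i. \<bar>H i j x - h n i j x\<bar>)) \<longlonglongrightarrow> 0"
    by (intro tendsto_add_zero tendsto_null_sum breaks sups) auto
  ultimately have "(\<lambda>n. pc_comp_rep r N a b (p n) q) \<longlonglongrightarrow> 0"
    using pc_comp_rep_commute[OF N p q] by simp
  then show ?thesis using q by blast
qed

section \<open>Convergence and the collapse index\<close>

text \<open>The metric dominates differences of breakpoints, so these form a real Cauchy sequence.
  Existence of the limits matters because the collapse index only tests convergence to
  \<open>0\<close>.\<close>

lemma pc_Cauchy_break_converges:
  assumes "2 \<le> N" "pc_Cauchy r N a b s" "i \<le> N"
  shows "\<exists>l. (\<lambda>n. pc_break a b (s n) i) \<longlonglongrightarrow> l"
proof -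
  interpret M: Metric_space "PC r N a b" "pc_comp r N a b" by (rule Metric_space_PC[OF assms(1)])
  have s: "s n \<in> PC r N a b" for n using assms(2) by (auto simp: M.MCauchy_def)
  have le: "\<bar>pc_break a b (s m) i - pc_break a b (s n) i\<bar> \<le> pc_comp r N a b (s m) (s n)" for m n
    using pc_comp_rep_ge(1)[OF assms(1) pc_rep_in(2)[OF s] pc_rep_in(2)[OF s] assms(3)] s
    by (simp add: pc_break_def pc_comp_def)
  have "Cauchy (\<lambda>n. pc_break a b (s n) i)"
    using assms(2) le unfolding M.MCauchy_def Cauchy_def dist_real_def by (meson le_less_trans)
  then show ?thesis by (simp add: Cauchy_convergent_iff convergent_def)
qed

lemma collapse_index_eq_0_iff:
  "collapse_index N a b s = 0 \<longleftrightarrow>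
    (\<forall>i\<in>{1..N}. \<not> (\<lambda>n. \<bar>pc_break a b (s n) (i - 1) - pc_break a b (s n) i\<bar>) \<longlonglongrightarrow> 0)"
  by (auto simp: collapse_index_def)

text \<open>Breakpoints depend continuously on the class, so the lengths of the pieces tend to those
  of the limit, which are positive.\<close>

lemma pc_convergent_imp_no_collapse:
  assumes N: "2 \<le> N" and "pc_convergent r N a b s" and s: "\<And>n. s n \<in> PC r N a b"
  shows "collapse_index N a b s = 0"
  unfolding collapse_index_eq_0_iff
proof (intro ballI notI)
  interpret M: Metric_space "PC r N a b" "pc_comp r N a b" by (rule Metric_space_PC[OF N])
  fix i assume i: "i \<in> {1..N}"
    and lim0: "(\<lambda>n. \<bar>pc_break a b (s n) (i - 1) - pc_break a b (s n) i\<bar>) \<longlonglongrightarrow> 0"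
  obtain F where F: "F \<in> PC r N a b" and sF: "(\<lambda>n. pc_comp r N a b (s n) F) \<longlonglongrightarrow> 0"
    using assms(2) s by (auto simp: M.limitin_metric_dist_null)
  have lim: "(\<lambda>n. pc_break a b (s n) k) \<longlonglongrightarrow> pc_break a b F k" if "k \<le> N" for k
  proof -
    have "\<bar>pc_break a b (s n) k - pc_break a b F k\<bar> \<le> pc_comp r N a b (s n) F" for n
      using pc_comp_rep_ge(1)[OF N pc_rep_in(2)[OF s] pc_rep_in(2)[OF F] that] s F
      by (simp add: pc_break_def pc_comp_def)
    then have "(\<lambda>n. pc_break a b (s n) k - pc_break a b F k) \<longlonglongrightarrow> 0"
      by (intro Lim_null_comparison[OF _ sF]) auto
    then show ?thesis by (simp add: LIM_zero_iff)
  qed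
  have "(\<lambda>n. \<bar>pc_break a b (s n) (i - 1) - pc_break a b (s n) i\<bar>)
      \<longlonglongrightarrow> \<bar>pc_break a b F (i - 1) - pc_break a b F i\<bar>"
    using i by (intro tendsto_intros lim) auto
  with lim0 have "pc_break a b F (i - 1) = pc_break a b F i"
    using LIMSEQ_unique by fastforce
  then show False
    using pc_maps_less[OF pc_rep_in(2)[OF F] N i] by (simp add: pc_break_def)
qed

text \<open>Passage to the limit orders consecutive limits of breakpoints weakly, and their equality
  would be a collapse; so the completeness result for representatives applies.\<close>

lemma no_collapse_imp_pc_convergent:
  assumes N: "2 \<le> N" and ab: "a < b" and C: "pc_Cauchy r N a b s"
    and "collapse_index N a b s = 0"
  shows "pc_convergent r N a b s"
proof -
  interpret M: Metric_space "PC r N a b" "pc_comp r N a b" by (rule Metric_space_PC[OF N])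
  have s: "s n \<in> PC r N a b" for n using C by (auto simp: M.MCauchy_def)
  define p where "p n = pc_rep (s n)" for n
  have p: "p n \<in> pc_maps r N a b" for n unfolding p_def by (rule pc_rep_in(2)[OF s])
  have ps: "p n \<in> s n" for n unfolding p_def by (rule pc_rep_in(1)[OF s])
  have "\<forall>i. \<exists>l. i \<le> N \<longrightarrow> (\<lambda>n. cpt a b (snd (p n)) i) \<longlonglongrightarrow> l"
    using pc_Cauchy_break_converges[OF N C] by (auto simp: pc_break_def p_def)
  then obtain c where c: "\<And>i. i \<le> N \<Longrightarrow> (\<lambda>n. cpt a b (snd (p n)) i) \<longlonglongrightarrow> c i"
    by metis
  have "c i < c (Suc i)" if "i < N" for i
  proof -
    have lt: "cpt a b (snd (p n)) i < cpt a b (snd (p n)) (Suc i)" for n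
      using pc_maps_less[OF p N, of "Suc i"] that by simp
    have "c i \<le> c (Suc i)"
      using c[of i] c[of "Suc i"] that lt by (intro LIMSEQ_le) (auto intro: less_imp_le)
    moreover have "c i \<noteq> c (Suc i)"
    proof
      assume eq: "c i = c (Suc i)"
      have "(\<lambda>n. \<bar>cpt a b (snd (p n)) i - cpt a b (snd (p n)) (Suc i)\<bar>) \<longlonglongrightarrow> \<bar>c i - c (Suc i)\<bar>"
        using that by (intro tendsto_intros c) auto
      then show False
        using assms(4) that eq unfolding collapse_index_eq_0_iff
        by (auto simp: pc_break_def p_def dest!: bspec[of _ _ "Suc i"])
    qed
    ultimately show ?thesis by simp
  qed
  moreover have "\<exists>M. \<forall>m\<ge>M. \<forall>n\<ge>M. pc_comp_rep r N a b (p m) (p n) < e" if "e > 0" for e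
    using C that s by (auto simp: M.MCauchy_def pc_comp_def p_def)
  ultimately obtain q where q: "q \<in> pc_maps r N a b"
    and lim: "(\<lambda>n. pc_comp_rep r N a b (p n) q) \<longlonglongrightarrow> 0"
    using pc_comp_rep_limit[OF N ab p _ c] by blast
  define Q where "Q = pc_rel r N a b `` {q}"
  have Q: "Q \<in> PC r N a b" unfolding Q_def PC_def using q by (rule quotientI)
  have "q \<in> Q" unfolding Q_def by (rule equiv_class_self[OF equiv_pc_rel q])
  \<comment> \<open>\<open>pc_comp_class\<close> allows \<open>q\<close> itself in place of the
    chosen representative of \<open>Q\<close>.\<close>
  then have "(\<lambda>n. pc_comp r N a b (s n) Q) \<longlonglongrightarrow> 0"
    using lim pc_comp_class[OF N s Q ps] by simp
  then show ?thesis using s Q by (auto simp: M.limitin_metric_dist_null)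
qed

text \<open>A constant sequence tends to \<open>0\<close> only if it is \<open>0\<close>, whereas
  consecutive breakpoints of one map are distinct.\<close>

lemma constant_breaks_no_collapse:
  assumes N: "2 \<le> N" and s: "\<And>n. s n \<in> PC r N a b"
    and const: "\<And>n i. i \<in> {1..N - 1} \<Longrightarrow> pc_break a b (s n) i = pc_break a b (s (Suc n)) i"
  shows "collapse_index N a b s = 0"
  unfolding collapse_index_eq_0_iff
proof (intro ballI notI)
  fix i assume i: "i \<in> {1..N}"
    and lim0: "(\<lambda>n. \<bar>pc_break a b (s n) (i - 1) - pc_break a b (s n) i\<bar>) \<longlonglongrightarrow> 0"
  define e where "e = pc_break a b (s 0)"
  have eq: "pc_break a b (s n) k = e k" if "k \<le> N" for n k
  proof (cases "k = 0 \<or> k = N")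
    \<comment> \<open>The hypothesis concerns the inner breakpoints; the outer two are the endpoints
      of the interval.\<close>
    case True
    then show ?thesis
      using cpt_N[OF pc_mapsD(1,2)[OF pc_rep_in(2)[OF s]] N] by (auto simp: e_def pc_break_def)
  next
    case False
    with that have "k \<in> {1..N - 1}" by auto
    then have step: "pc_break a b (s (Suc n)) k = pc_break a b (s n) k" for n
      by (rule const[symmetric])
    show ?thesis by (induction n) (simp_all add: step e_def)
  qed
  have "i - 1 \<le> N" "i \<le> N" using i by auto
  with lim0 have "(\<lambda>n. \<bar>e (i - 1) - e i\<bar>) \<longlonglongrightarrow> 0"
    by (simp only: eq)
  then have "e (i - 1) = e i"
    by (simp add: LIMSEQ_const_iff)
  then show False
    using pc_maps_less[OF pc_rep_in(2)[OF s[of 0]] N i] by (simp add: e_def pc_break_def)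
qed

theorem theorem4p5:
  fixes a b :: real and N r :: nat and s :: "nat \<Rightarrow> pcmap set"
  assumes "a < b" and "2 \<le> N"
    and "pc_Cauchy r N a b s"
  shows "(pc_convergent r N a b s \<longleftrightarrow> collapse_index N a b s = 0) \<and>
    (\<forall>t. pc_Cauchy r N a b t \<and>
         (\<forall>n. \<forall>i\<in>{1..N - 1}. pc_break a b (t n) i = pc_break a b (t (Suc n)) i)
       \<longrightarrow> pc_convergent r N a b t)"
proof -
  have PC: "t n \<in> PC r N a b" if "pc_Cauchy r N a b t" for t n
    using that by (auto simp: Metric_space.MCauchy_def[OF Metric_space_PC[OF assms(2)]])
  \<comment> \<open>Proved for every Cauchy sequence, since both claims of the theorem use
    it.\<close>
  have iff: "pc_convergent r N a b t \<longleftrightarrow> collapse_index N a b t = 0" if t: "pc_Cauchy r N a b t" for t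
  proof
    assume "pc_convergent r N a b t"
    then show "collapse_index N a b t = 0"
      by (rule pc_convergent_imp_no_collapse[OF assms(2) _ PC[OF t]])
  qed (rule no_collapse_imp_pc_convergent[OF assms(2,1) t])
  show ?thesis
  proof (intro conjI allI impI)
    show "pc_convergent r N a b s \<longleftrightarrow> collapse_index N a b s = 0" by (rule iff[OF assms(3)])
    fix t
    assume t: "pc_Cauchy r N a b t \<and>
      (\<forall>n. \<forall>i\<in>{1..N - 1}. pc_break a b (t n) i = pc_break a b (t (Suc n)) i)"
    then have "t n \<in> PC r N a b" for n using PC by blast
    then have "collapse_index N a b t = 0"
      by (rule constant_breaks_no_collapse[OF assms(2)]) (use t in blast)
    then show "pc_convergent r N a b t" using iff[of t] t by blast
  qed
qed

end
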